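(* Let $(S,\ll)$ and $(S',\ll')$ be proximity Baer-Specker algebras. A map $\alpha:S\to S'$ is a proximity morphism if and only if it is a weak proximity morphism.
   Context: All algebras are commutative and unital. A $\mathbf{ba\ell}$-algebra is a lattice-ordered $\mathbb R$-algebra $A$ (order translation-invariant, products of nonnegative elements nonnegative, nonnegative scalar multiples of nonnegative elements nonnegative) which is bounded (for each $a$ there is an integer $n\ge1$ with $a\le n\cdot1$) and archimedean ($na\le b$ for all integers $n\ge1$ implies $a\le0$). Real numbers $r$ are identified with $r\cdot1\in A$. A Specker algebra is a commutative unital $\mathbb R$-algebra generated as an $\mathbb R$-algebra by its idempotents; each Specker algebra is a $\mathbf{ba\ell}$-algebra. It is Baer-Specker if it is a Baer ring, i.e. each annihilator ideal is generated by an idempotent. A proximity Baer-Specker algebra is a pair $(S,\ll)$ where $S$ is a Baer-Specker algebra and $\ll$ is a proximity on $S$, i.e. a binary relation such that: (P1) $0\ll0$ and $1\ll1$; (P2) $a\ll b$ implies $a\le b$; (P3) $a\le b\ll c\le d$ implies $a\ll d$; (P4) $a\ll b,c$ implies $a\ll b\wedge c$; (P5) $a\ll b$ implies $-b\ll-a$; (P6) $a\ll b$ and $c\ll d$ imply $a+c\ll b+d$; (P7) $a\ll b$ and $0<r\in\mathbb R$ imply $ra\ll rb$; (P8) $a,b,c,d\ge0$ with $a\ll b$ and $c\ll d$ imply $ac\ll bd$; (P9) $a\ll b$ implies there is $c\in S$ with $a\ll c\ll b$; (P10) $a>0$ implies there is $0<b\in S$ with $b\ll a$. A map $\alpha:S\to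 S'$ is a proximity morphism if for all $a,b,c\in S$ with $c\ll c$ and $0<r\in\mathbb R$: (PM1) $\alpha(0)=0$, $\alpha(1)=1$; (PM2) $\alpha(a\wedge b)=\alpha(a)\wedge\alpha(b)$; (PM3) $a\ll b$ implies $-\alpha(-a)\ll'\alpha(b)$; (PM4) $\alpha(b)=\bigvee\{\alpha(x): x\ll b\}$ (join in $S'$); (PM5) $\alpha(ra)=r\alpha(a)$; (PM6) $\alpha(a\vee c)=\alpha(a)\vee\alpha(c)$; (PM7) $\alpha(a+c)=\alpha(a)+\alpha(c)$; (PM8) $c\ge0$ implies $\alpha(ca)=\alpha(c)\alpha(a)$. A map $\alpha:S\to S'$ is a weak proximity morphism if it satisfies (PM1)–(PM5) and, for all $a\in S$ and $r\in\mathbb R$: (PM6$'$) $\alpha(a\vee r)=\alpha(a)\vee r$; (PM7$'$) $\alpha(a+r)=\alpha(a)+r$. *)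

theory Defs
  imports "HOL-Library.Lattice_Algebras" "HOL-Library.Lub_Glb"
begin

text \<open>
  Algebras are rendered as types. The classes \<^class>\<open>comm_ring_1\<close> and \<^class>\<open>real_algebra_1\<close> are
  avoided because they impose \<open>0 \<noteq> 1\<close>; the zero algebra is allowed here. Consequently
  \<^const>\<open>of_real\<close> is not available, and a real number \<open>r\<close> is identified with \<open>r *\<^sub>R 1\<close>.
\<close>

class comm_unital_real_algebra = comm_ring + comm_monoid_mult + real_algebra

class bal_algebra = comm_unital_real_algebra + ordered_comm_ring + lattice_ab_group_add +
    ordered_real_vector +
  assumes bal_bounded: "\<exists>n::nat. 1 \<le> n \<and> a \<le> real n *\<^sub>R 1"
    and bal_archimedean: "(\<And>n::nat. 1 \<le> n \<Longrightarrow> real n *\<^sub>R a \<le> b) \<Longrightarrow> a \<le> 0"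

definition (in times) is_idempotent :: "'a \<Rightarrow> bool"
  where "is_idempotent e \<longleftrightarrow> e * e = e"

definition (in comm_unital_real_algebra) real_subalgebra :: "'a set \<Rightarrow> bool"
  where "real_subalgebra T \<longleftrightarrow> 0 \<in> T \<and> 1 \<in> T \<and> (\<forall>x\<in>T. \<forall>y\<in>T. x + y \<in> T \<and> x * y \<in> T) \<and>
    (\<forall>r. \<forall>x\<in>T. r *\<^sub>R x \<in> T)"

class specker_algebra = comm_unital_real_algebra +
  assumes idempotent_generated: "real_subalgebra hull {e. is_idempotent e} = UNIV"

definition (in mult_zero) annihilator :: "'a set \<Rightarrow> 'a set"
  where "annihilator X = {a. \<forall>x\<in>X. a * x = 0}"

class baer_specker_algebra = specker_algebra +
  assumes baer: "\<exists>e. is_idempotent e \<and> annihilator X = range (\<lambda>a. a * e)"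

text \<open>
  A Specker algebra carries exactly one order making it a bounded archimedean lattice-ordered
  algebra (an element is nonnegative iff it is a nonnegative combination of idempotents), so
  adding the order as part of the structure below involves no choice.
\<close>

class ordered_baer_specker_algebra = baer_specker_algebra + bal_algebra

locale proximity =
  fixes prox :: "'a::ordered_baer_specker_algebra \<Rightarrow> 'a \<Rightarrow> bool"  (infix \<open>\<lless>\<close> 50)
  assumes P1: "0 \<lless> 0" "1 \<lless> 1"
    and P2: "a \<lless> b \<Longrightarrow> a \<le> b"
    and P3: "a \<le> b \<Longrightarrow> b \<lless> c \<Longrightarrow> c \<le> d \<Longrightarrow> a \<lless> d"
    and P4: "a \<lless> b \<Longrightarrow> a \<lless> c \<Longrightarrow> a \<lless> inf b c"
    and P5: "a \<lless> b \<Longrightarrow> - b \<lless> - a"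
    and P6: "a \<lless> b \<Longrightarrow> c \<lless> d \<Longrightarrow> a + c \<lless> b + d"
    and P7: "a \<lless> b \<Longrightarrow> 0 < r \<Longrightarrow> r *\<^sub>R a \<lless> r *\<^sub>R b"
    and P8: "0 \<le> a \<Longrightarrow> 0 \<le> b \<Longrightarrow> 0 \<le> c \<Longrightarrow> 0 \<le> d \<Longrightarrow> a \<lless> b \<Longrightarrow> c \<lless> d \<Longrightarrow> a * c \<lless> b * d"
    and P9: "a \<lless> b \<Longrightarrow> \<exists>c. a \<lless> c \<and> c \<lless> b"
    and P10: "0 < a \<Longrightarrow> \<exists>b. 0 < b \<and> b \<lless> a"

locale proximity_map =
  fixes prox :: "'a::ordered_baer_specker_algebra \<Rightarrow> 'a \<Rightarrow> bool"  (infix \<open>\<lless>\<close> 50)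
    and prox' :: "'b::ordered_baer_specker_algebra \<Rightarrow> 'b \<Rightarrow> bool"  (infix \<open>\<lless>''\<close> 50)
    and \<alpha> :: "'a \<Rightarrow> 'b"
  assumes PM1: "\<alpha> 0 = 0" "\<alpha> 1 = 1"
    and PM2: "\<alpha> (inf a b) = inf (\<alpha> a) (\<alpha> b)"
    and PM3: "a \<lless> b \<Longrightarrow> - \<alpha> (- a) \<lless>' \<alpha> b"
    and PM4: "isLub UNIV {\<alpha> x |x. x \<lless> b} (\<alpha> b)"
    and PM5: "0 < r \<Longrightarrow> \<alpha> (r *\<^sub>R a) = r *\<^sub>R \<alpha> a"

locale proximity_morphism = proximity_map +
  assumes PM6: "c \<lless> c \<Longrightarrow> \<alpha> (sup a c) = sup (\<alpha> a) (\<alpha> c)"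
    and PM7: "c \<lless> c \<Longrightarrow> \<alpha> (a + c) = \<alpha> a + \<alpha> c"
    and PM8: "c \<lless> c \<Longrightarrow> 0 \<le> c \<Longrightarrow> \<alpha> (c * a) = \<alpha> c * \<alpha> a"

locale weak_proximity_morphism = proximity_map +
  assumes PM6': "\<alpha> (sup a (r *\<^sub>R 1)) = sup (\<alpha> a) (r *\<^sub>R 1)"
    and PM7': "\<alpha> (a + r *\<^sub>R 1) = \<alpha> a + r *\<^sub>R 1"

end

theory Submission
  imports Defs
begin

text \<open>
  Every element \<open>c\<close> of a Specker algebra takes finitely many real values, and if \<open>c\<close> is reflexive
  (\<open>c \<lless> c\<close>), then so are the idempotents cutting out its level sets, as they are lattice polynomials
  in \<open>c\<close>. A weak proximity morphism \<open>\<alpha>\<close> maps an idempotent \<open>e\<close> to an idempotent, and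
  \<open>\<alpha> a * \<alpha> e\<close> depends only on \<open>a * e\<close>; if \<open>e\<close> is reflexive, then moreover
  \<open>\<alpha> (1 - e) = 1 - \<alpha> e\<close>. Hence the level sets of a reflexive \<open>c\<close> are carried to a partition
  of unity in the target, and on each of its members \<open>c\<close> may be replaced by a real constant.
\<close>

section \<open>Idempotents in bounded lattice-ordered algebras\<close>

lemma bal_zero_le_one: "(0::'a::bal_algebra) \<le> 1"
proof -
  obtain n :: nat where n: "1 \<le> n" "(0::'a) \<le> real n *\<^sub>R 1"
    using bal_bounded by blast
  have "(0::'a) \<le> (1 / real n) *\<^sub>R (real n *\<^sub>R 1)"
    by (rule scaleR_nonneg_nonneg[OF _ n(2)]) simp
  moreover have "(1 / real n) *\<^sub>R (real n *\<^sub>R (1::'a)) = 1" using n(1) by simp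
  ultimately show ?thesis by metis
qed

lemma bal_bounded_nat:
  fixes a :: "'a::bal_algebra"
  obtains n :: nat where "1 \<le> n" "a \<le> real n *\<^sub>R 1"
  using bal_bounded by blast

lemma inf_scaleR_eq_0:
  fixes a b :: "'a::bal_algebra"
  assumes "inf a b = 0" "1 \<le> r"
  shows "inf (r *\<^sub>R a) (r *\<^sub>R b) = 0"
proof (rule antisym)
  have ab: "0 \<le> a" "0 \<le> b" using assms(1) by (metis inf.cobounded1, metis inf.cobounded2)
  let ?z = "inf (r *\<^sub>R a) (r *\<^sub>R b)"
  have "(1 / r) *\<^sub>R ?z \<le> (1 / r) *\<^sub>R (r *\<^sub>R a)" "(1 / r) *\<^sub>R ?z \<le> (1 / r) *\<^sub>R (r *\<^sub>R b)"
    using assms(2) by (auto intro!: scaleR_left_mono simp del: scaleR_scaleR)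
  then have "(1 / r) *\<^sub>R ?z \<le> inf a b" using assms(2) by simp
  then have "r *\<^sub>R ((1 / r) *\<^sub>R ?z) \<le> r *\<^sub>R 0"
    unfolding assms(1) using assms(2) by (intro scaleR_left_mono) auto
  then show "?z \<le> 0" using assms(2) by simp
  show "0 \<le> ?z" using ab assms(2) by (simp add: scaleR_nonneg_nonneg)
qed

text \<open>Boundedness gives \<open>n\<close> with \<open>a\<close> and \<open>b\<close> below
  \<open>n\<close>, so the product lies below both \<open>n a\<close> and \<open>n b\<close>, which
  are still disjoint.\<close>

lemma disjoint_mult_eq_0:
  fixes a b :: "'a::bal_algebra"
  assumes "inf a b = 0"
  shows "a * b = 0"
proof -
  have ab: "0 \<le> a" "0 \<le> b" using assms by (metis inf.cobounded1, metis inf.cobounded2)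
  obtain n :: nat where n: "1 \<le> n" "sup a b \<le> real n *\<^sub>R 1" by (rule bal_bounded_nat)
  have n': "a \<le> real n *\<^sub>R 1" "b \<le> real n *\<^sub>R 1" using n by simp_all
  have "a * b \<le> a * (real n *\<^sub>R 1)" "a * b \<le> (real n *\<^sub>R 1) * b"
    using mult_left_mono[OF n'(2) ab(1)] mult_right_mono[OF n'(1) ab(2)] by simp_all
  then have "a * b \<le> inf (real n *\<^sub>R a) (real n *\<^sub>R b)" by simp
  also have "\<dots> = 0" using inf_scaleR_eq_0[OF assms, of "real n"] n by simp
  finally show ?thesis using ab by (simp add: antisym)
qed

text \<open>Split \<open>a\<close> into positive and negative parts \<open>p\<close> and
  \<open>q\<close>: these are disjoint, so the cross terms vanish and the square is
  \<open>p * p + q * q\<close>.\<close>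

lemma square_nonneg:
  fixes a :: "'a::bal_algebra"
  shows "0 \<le> a * a"
proof -
  define p q where "p = sup a 0" and "q = sup (- a) 0"
  have a: "a = p - q" unfolding p_def q_def
    by (metis add_sup_distrib_left add.right_inverse add.right_neutral diff_eq_eq sup_commute)
  have pq: "inf p q = 0"
  proof -
    have "inf p q = q + inf a 0" unfolding a by (simp add: add_inf_distrib_left)
    also have "inf a 0 = - q" unfolding q_def by simp
    finally show ?thesis by simp
  qed
  then have 0: "p * q = 0" by (rule disjoint_mult_eq_0)
  have "a * a = p * p + q * q"
    unfolding a using 0 by (simp add: algebra_simps)
  moreover have "0 \<le> p" "0 \<le> q" by (simp_all add: p_def q_def)
  ultimately show ?thesis by simp
qed

lemma is_idempotent_diff:
  fixes e :: "'a::comm_unital_real_algebra"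
  shows "is_idempotent e \<Longrightarrow> is_idempotent (1 - e)"
  by (simp add: is_idempotent_def algebra_simps)

lemma idempotent_nonneg:
  fixes e :: "'a::bal_algebra"
  shows "is_idempotent e \<Longrightarrow> 0 \<le> e"
  using square_nonneg[of e] by (simp add: is_idempotent_def)

lemma idempotent_le_one:
  fixes e :: "'a::bal_algebra"
  shows "is_idempotent e \<Longrightarrow> e \<le> 1"
  using idempotent_nonneg[OF is_idempotent_diff, of e] by simp

lemma split_by_idempotent:
  fixes a b e :: "'a::comm_unital_real_algebra"
  assumes "a * e = b * e" "a * (1 - e) = b * (1 - e)"
  shows "a = b"
  using assms by (simp add: algebra_simps)

text \<open>Subtracting the infimum leaves disjoint elements \<open>u\<close> and \<open>v\<close>.
  Since \<open>0 \<le> e \<le> 1\<close>, multiplying by \<open>e\<close> only shrinks them, so they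
  stay disjoint; adding the infimum back gives the claim.\<close>

lemma inf_mult_idempotent:
  fixes x y e :: "'a::bal_algebra"
  assumes "is_idempotent e"
  shows "inf x y * e = inf (x * e) (y * e)"
proof -
  define u v where "u = x - inf x y" and "v = y - inf x y"
  have e: "0 \<le> e" "e \<le> 1" using assms by (simp_all add: idempotent_nonneg idempotent_le_one)
  have uv: "inf u v = 0"
    unfolding u_def v_def diff_conv_add_uminus add_inf_distrib_right[symmetric]
    by (rule add.right_inverse)
  then have uv0: "0 \<le> u" "0 \<le> v" by (metis inf.cobounded1, metis inf.cobounded2)
  then have "u * e \<le> u" "v * e \<le> v"
    using e(2) mult_left_mono[of e 1] by fastforce+
  then have "inf (u * e) (v * e) \<le> 0" using uv by (metis inf_mono)
  moreover have "0 \<le> inf (u * e) (v * e)" using e uv0 by simp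
  ultimately have 0: "inf (u * e) (v * e) = 0" by simp
  have xy: "x * e = inf x y * e + u * e" "y * e = inf x y * e + v * e"
    by (simp_all add: u_def v_def distrib_right[symmetric] del: diff_inf_eq_sup)
  show ?thesis
    unfolding xy by (simp only: add_inf_distrib_left[symmetric] 0 add_0_right)
qed

lemma sup_mult_idempotent:
  fixes x y e :: "'a::bal_algebra"
  assumes "is_idempotent e"
  shows "sup x y * e = sup (x * e) (y * e)"
proof -
  have "sup x y * e = - (inf (- x) (- y) * e)"
    by (simp only: neg_sup_eq_inf[symmetric] mult_minus_left minus_minus)
  also have "\<dots> = - inf (- (x * e)) (- (y * e))"
    by (simp only: inf_mult_idempotent[OF assms] mult_minus_left)
  also have "\<dots> = sup (x * e) (y * e)" by (simp add: neg_inf_eq_sup)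
  finally show ?thesis .
qed

text \<open>On each of the pieces \<open>e\<close> and \<open>1 - e\<close>, one of the two
  arguments vanishes and the other is nonnegative.\<close>

lemma inf_idempotent_diff:
  fixes e :: "'a::bal_algebra"
  assumes "is_idempotent e"
  shows "inf e (1 - e) = 0"
proof (rule split_by_idempotent[where e = e])
  have e: "0 \<le> e" "e \<le> 1" using assms by (simp_all add: idempotent_nonneg idempotent_le_one)
  have ee: "e * e = e" "(1 - e) * e = 0" "e * (1 - e) = 0" "(1 - e) * (1 - e) = 1 - e"
    using assms by (simp_all add: is_idempotent_def left_diff_distrib right_diff_distrib)
  show "inf e (1 - e) * e = 0 * e"
    using e by (simp add: inf_mult_idempotent[OF assms] ee inf_absorb2)
  show "inf e (1 - e) * (1 - e) = 0 * (1 - e)"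
    using e by (simp add: inf_mult_idempotent[OF is_idempotent_diff[OF assms]] ee inf_absorb1)
qed

text \<open>Rewrites multiplication by an idempotent in terms of infimum and scaling, which a weak
  proximity morphism respects. On \<open>e\<close> the bound \<open>r\<close> makes \<open>a\<close>
  the smaller argument; on \<open>1 - e\<close> the other argument vanishes.\<close>

lemma mult_idempotent_eq_inf:
  fixes a e :: "'a::bal_algebra"
  assumes "is_idempotent e" "0 \<le> a" "a \<le> r *\<^sub>R 1"
  shows "a * e = inf a (r *\<^sub>R e)"
proof (rule split_by_idempotent[where e = e])
  have e: "0 \<le> e" "e \<le> 1" using assms by (simp_all add: idempotent_nonneg idempotent_le_one)
  have ee: "e * e = e" using assms by (simp add: is_idempotent_def)
  have "a * e \<le> (r *\<^sub>R 1) * e" using assms e by (intro mult_right_mono)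
  then show "a * e * e = inf a (r *\<^sub>R e) * e"
    using assms ee by (simp add: inf_mult_idempotent mult.assoc inf_absorb1)
  have "0 \<le> a * (1 - e)" using assms e by simp
  moreover have "e * (1 - e) = 0" using ee by (simp add: algebra_simps)
  ultimately show "a * e * (1 - e) = inf a (r *\<^sub>R e) * (1 - e)"
    by (simp add: inf_mult_idempotent[OF is_idempotent_diff[OF assms(1)]] mult.assoc inf_absorb2)
qed


section \<open>Finite spectra in Specker algebras\<close>

text \<open>
  The members of \<open>E\<close> need not be orthogonal: faithfulness of \<open>E\<close> (its last property) survives
  common refinement, and no sum of idempotents has to be computed.
\<close>

definition finite_spectrum :: "'a::comm_unital_real_algebra \<Rightarrow> bool" where
  "finite_spectrum c \<longleftrightarrow> (\<exists>E. finite E \<and>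
     (\<forall>e\<in>E. is_idempotent e \<and> (\<exists>r. c * e = r *\<^sub>R e)) \<and>
     (\<forall>x. (\<forall>e\<in>E. x * e = 0) \<longrightarrow> x = 0))"

lemma finite_spectrumE:
  assumes "finite_spectrum c"
  obtains E where "finite E" "\<And>e. e \<in> E \<Longrightarrow> is_idempotent e"
    "\<And>e. e \<in> E \<Longrightarrow> \<exists>r. c * e = r *\<^sub>R e" "\<And>x. (\<And>e. e \<in> E \<Longrightarrow> x * e = 0) \<Longrightarrow> x = 0"
  using assms unfolding finite_spectrum_def by (elim exE conjE) simp

lemma finite_spectrum_idempotent:
  fixes p :: "'a::comm_unital_real_algebra"
  assumes "is_idempotent p"
  shows "finite_spectrum p"
  unfolding finite_spectrum_def
proof (intro exI[of _ "{p, 1 - p}"] conjI ballI allI impI)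
  fix e assume e: "e \<in> {p, 1 - p}"
  then show "is_idempotent e" using assms by (auto intro: is_idempotent_diff)
  have "p * p = 1 *\<^sub>R p" "p * (1 - p) = 0 *\<^sub>R (1 - p)"
    using assms by (simp_all add: is_idempotent_def algebra_simps)
  then show "\<exists>r. p * e = r *\<^sub>R e" using e by blast
next
  fix x assume "\<forall>e\<in>{p, 1 - p}. x * e = 0"
  then show "x = 0" by (intro split_by_idempotent[of x p 0]) auto
qed simp

text \<open>The products \<open>e * f\<close> refine both families. Faithfulness passes to them in
  two stages: an \<open>x\<close> killed by all products has each \<open>x * e\<close> killed by
  \<open>F\<close>, so every \<open>x * e\<close> is zero, and then \<open>x\<close> is
  zero.\<close>

lemma finite_spectrum_common:
  fixes c d :: "'a::comm_unital_real_algebra"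
  assumes "finite_spectrum c" "finite_spectrum d"
    and step: "\<And>e r s. is_idempotent e \<Longrightarrow> c * e = r *\<^sub>R e \<Longrightarrow> d * e = s *\<^sub>R e \<Longrightarrow> \<exists>t. g * e = t *\<^sub>R e"
  shows "finite_spectrum g"
proof -
  obtain E where
    E: "finite E" "\<And>e. e \<in> E \<Longrightarrow> is_idempotent e" "\<And>e. e \<in> E \<Longrightarrow> \<exists>r. c * e = r *\<^sub>R e"
      "\<And>x. (\<And>e. e \<in> E \<Longrightarrow> x * e = 0) \<Longrightarrow> x = 0"
    using assms(1) by (rule finite_spectrumE) blast
  obtain F where
    F: "finite F" "\<And>e. e \<in> F \<Longrightarrow> is_idempotent e" "\<And>e. e \<in> F \<Longrightarrow> \<exists>r. d * e = r *\<^sub>R e"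
      "\<And>x. (\<And>e. e \<in> F \<Longrightarrow> x * e = 0) \<Longrightarrow> x = 0"
    using assms(2) by (rule finite_spectrumE) blast
  show ?thesis unfolding finite_spectrum_def
  proof (intro exI[of _ "(\<lambda>(e, f). e * f) ` (E \<times> F)"] conjI ballI allI impI)
    show "finite ((\<lambda>(e, f). e * f) ` (E \<times> F))" using E(1) F(1) by simp
  next
    fix p assume "p \<in> (\<lambda>(e, f). e * f) ` (E \<times> F)"
    then obtain e f where p: "p = e * f" "e \<in> E" "f \<in> F" by auto
    have ef: "e * e = e" "f * f = f" using E(2) F(2) p by (auto simp: is_idempotent_def)
    have "p * p = (e * e) * (f * f)" by (simp add: p ac_simps)
    then show i: "is_idempotent p" by (simp add: ef p is_idempotent_def)
    obtain r where "c * e = r *\<^sub>R e" using E(3) p by blast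
    then have "c * p = r *\<^sub>R p" by (metis p(1) mult.assoc mult_scaleR_left)
    moreover obtain s where "d * f = s *\<^sub>R f" using F(3) p by blast
    then have "d * p = s *\<^sub>R p" by (metis p(1) mult.left_commute mult_scaleR_right)
    ultimately show "\<exists>t. g * p = t *\<^sub>R p" using i step by blast
  next
    fix x assume x: "\<forall>p\<in>(\<lambda>(e, f). e * f) ` (E \<times> F). x * p = 0"
    have "x * e = 0" if "e \<in> E" for e
    proof (rule F(4))
      fix f assume "f \<in> F"
      then show "x * e * f = 0" using x that by (auto simp: mult.assoc)
    qed
    then show "x = 0" by (rule E(4))
  qed
qed

lemma finite_spectrum_add:
  fixes c d :: "'a::comm_unital_real_algebra"
  assumes "finite_spectrum c" "finite_spectrum d"
  shows "finite_spectrum (c + d)"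
proof (rule finite_spectrum_common[OF assms])
  fix e r s assume "c * e = r *\<^sub>R e" "d * e = s *\<^sub>R e"
  then show "\<exists>t. (c + d) * e = t *\<^sub>R e"
    by (intro exI[of _ "r + s"]) (simp add: algebra_simps)
qed

lemma finite_spectrum_mult:
  fixes c d :: "'a::comm_unital_real_algebra"
  assumes "finite_spectrum c" "finite_spectrum d"
  shows "finite_spectrum (c * d)"
proof (rule finite_spectrum_common[OF assms])
  fix e r s assume "c * e = r *\<^sub>R e" "d * e = s *\<^sub>R e"
  then show "\<exists>t. (c * d) * e = t *\<^sub>R e"
    by (intro exI[of _ "r * s"]) (simp add: mult.assoc mult.left_commute)
qed

lemma finite_spectrum_scaleR:
  fixes c :: "'a::comm_unital_real_algebra"
  assumes "finite_spectrum c"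
  shows "finite_spectrum (k *\<^sub>R c)"
proof (rule finite_spectrum_common[OF assms assms])
  fix e r assume "c * e = r *\<^sub>R e"
  then show "\<exists>t. (k *\<^sub>R c) * e = t *\<^sub>R e" by (intro exI[of _ "k * r"]) simp
qed

text \<open>Elements of finite spectrum form a subalgebra containing the idempotents, and these
  generate everything.\<close>

lemma specker_finite_spectrum: "finite_spectrum (c::'a::specker_algebra)"
proof -
  have "real_subalgebra (Collect (finite_spectrum :: 'a \<Rightarrow> bool))"
    unfolding real_subalgebra_def
    by (auto intro: finite_spectrum_add finite_spectrum_mult finite_spectrum_scaleR
        finite_spectrum_idempotent simp: is_idempotent_def)
  then have "real_subalgebra hull {e::'a. is_idempotent e} \<subseteq> Collect finite_spectrum"
    by (intro hull_minimal) (auto intro: finite_spectrum_idempotent)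
  then show ?thesis unfolding idempotent_generated by auto
qed


section \<open>Level sets of reflexive elements\<close>

text \<open>The tent function \<open>max 0 (1 - N * \<bar>c - r\<bar>)\<close>, with the absolute
  value spelled as a supremum. Once \<open>1 / N\<close> is at most the gap from \<open>r\<close> to
  every other value of \<open>c\<close>, it is the indicator of the level set where \<open>c\<close>
  equals \<open>r\<close>.\<close>

definition level_idempotent :: "real \<Rightarrow> real \<Rightarrow> 'a::bal_algebra \<Rightarrow> 'a" where
  "level_idempotent N r c = sup 0 (1 - N *\<^sub>R sup (c - r *\<^sub>R 1) (- (c - r *\<^sub>R 1)))"

lemma level_idempotent_mult:
  fixes c e :: "'a::bal_algebra"
  assumes e: "is_idempotent e" and s: "c * e = s *\<^sub>R e" and N: "s = r \<or> 1 \<le> N * \<bar>s - r\<bar>"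
  shows "level_idempotent N r c * e = (if s = r then e else 0)"
proof -
  have e0: "0 \<le> e" using e by (rule idempotent_nonneg)
  have cr: "(c - r *\<^sub>R 1) * e = (s - r) *\<^sub>R e" by (simp add: algebra_simps s)
  have abs: "sup (t *\<^sub>R e) (- (t *\<^sub>R e)) = \<bar>t\<bar> *\<^sub>R e" for t
  proof (cases "0 \<le> t")
    case True
    then have "0 \<le> t *\<^sub>R e" using e0 by (simp add: scaleR_nonneg_nonneg)
    then show ?thesis using True by (simp add: sup_absorb1 minus_le_iff order_trans[of _ 0])
  next
    case False
    then have "t *\<^sub>R e \<le> 0" using e0 by (simp add: scaleR_nonpos_nonneg)
    then show ?thesis using False by (simp add: sup_absorb2 le_minus_iff order_trans[of _ 0])
  qed
  have "sup (c - r *\<^sub>R 1) (- (c - r *\<^sub>R 1)) * e = \<bar>s - r\<bar> *\<^sub>R e"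
    by (simp only: sup_mult_idempotent[OF e] cr abs mult_minus_left)
  then have "level_idempotent N r c * e = sup 0 ((1 - N * \<bar>s - r\<bar>) *\<^sub>R e)"
    unfolding level_idempotent_def
    by (simp only: sup_mult_idempotent[OF e] left_diff_distrib mult_scaleR_left mult_zero_left
        mult_1_left) (simp add: left_diff_distrib scaleR_left_diff_distrib)
  moreover have "(1 - N * \<bar>s - r\<bar>) *\<^sub>R e \<le> 0" if "s \<noteq> r"
    using that N e0 by (intro scaleR_nonpos_nonneg) auto
  ultimately show ?thesis using e0 by (auto simp: sup_absorb1 sup_absorb2)
qed

section \<open>Closure properties of reflexive elements and their level sets\<close>

context proximity
begin

lemma reflexive_scaleR_one: "r *\<^sub>R 1 \<lless> r *\<^sub>R 1"
proof (cases r "0::real" rule: linorder_cases)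
  case less
  then show ?thesis using P5[OF P7[OF P1(2), of "- r"]] by simp
qed (use P1 P7 in auto)

lemma reflexive_inf: "a \<lless> a \<Longrightarrow> b \<lless> b \<Longrightarrow> inf a b \<lless> inf a b"
  by (meson P3 P4 inf.cobounded1 inf.cobounded2 order_refl)

lemma reflexive_sup:
  assumes "a \<lless> a" "b \<lless> b"
  shows "sup a b \<lless> sup a b"
  using P5[OF reflexive_inf[OF P5[OF assms(1)] P5[OF assms(2)]]]
  by (simp add: neg_inf_eq_sup)

lemma reflexive_diff: "a \<lless> a \<Longrightarrow> b \<lless> b \<Longrightarrow> a - b \<lless> a - b"
  using P6[of a a "- b" "- b"] P5[of b b] by simp

lemma reflexive_level_idempotent:
  assumes "c \<lless> c" "0 < N"
  shows "level_idempotent N r c \<lless> level_idempotent N r c"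
  unfolding level_idempotent_def
  by (intro reflexive_sup reflexive_diff P5 P7 P1 reflexive_scaleR_one assms)

text \<open>The \<open>h r\<close> are tent functions at the finitely many values of
  \<open>c\<close>. They are reflexive because they are built from \<open>c\<close> and constants by
  lattice and linear operations; all equations are checked on the faithful family
  \<open>E\<close>.\<close>

lemma reflexive_decomposition:
  assumes "c \<lless> c"
  obtains R h where "finite R" "\<And>r. r \<in> R \<Longrightarrow> is_idempotent (h r)" "\<And>r. r \<in> R \<Longrightarrow> h r \<lless> h r"
    "\<And>r. r \<in> R \<Longrightarrow> c * h r = r *\<^sub>R h r" "(\<Sum>r\<in>R. h r) = 1"
proof -
  obtain E where E: "finite E" "\<And>e. e \<in> E \<Longrightarrow> is_idempotent e"
      "\<And>e. e \<in> E \<Longrightarrow> \<exists>r. c * e = r *\<^sub>R e" "\<And>x. (\<And>e. e \<in> E \<Longrightarrow> x * e = 0) \<Longrightarrow> x = 0"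
    using specker_finite_spectrum[of c] by (rule finite_spectrumE) blast
  obtain \<rho> where \<rho>: "\<And>e. e \<in> E \<Longrightarrow> c * e = \<rho> e *\<^sub>R e" using E(3) by metis
  define R where "R = \<rho> ` E"
  have R: "finite R" using E(1) by (simp add: R_def)
  \<comment> \<open>The extra element 1 keeps \<open>D\<close> nonempty when \<open>c\<close> has at
    most one value, so that \<open>Min D\<close> exists and is positive.\<close>
  define D where "D = insert 1 ((\<lambda>(s, r). \<bar>s - r\<bar>) ` {(s, r) \<in> R \<times> R. s \<noteq> r})"
  have "finite {(s, r) \<in> R \<times> R. s \<noteq> r}"
    by (rule finite_subset[of _ "R \<times> R"]) (use R in auto)
  then have D: "finite D" "D \<noteq> {}" "\<And>d. d \<in> D \<Longrightarrow> 0 < d" by (auto simp: D_def)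
  define N where "N = 1 / Min D"
  have "0 < Min D" using D by simp
  then have N0: "0 < N" by (simp add: N_def)
  have N: "s = r \<or> 1 \<le> N * \<bar>s - r\<bar>" if "s \<in> R" "r \<in> R" for s r
  proof (cases "s = r")
    case False
    then have "\<bar>s - r\<bar> \<in> D" using that by (force simp: D_def)
    then have "Min D \<le> \<bar>s - r\<bar>" using D by simp
    then show ?thesis using \<open>0 < Min D\<close> by (simp add: N_def field_simps)
  qed simp
  define h where "h r = level_idempotent N r c" for r
  have h: "h r * e = (if \<rho> e = r then e else 0)" if "r \<in> R" "e \<in> E" for r e
    unfolding h_def by (rule level_idempotent_mult) (use that E \<rho> N R_def in auto)
  \<comment> \<open>Faithfulness of \<open>E\<close> applied to the difference
    \<open>x - y\<close>.\<close>
  have local: "x = y" if "\<And>e. e \<in> E \<Longrightarrow> x * e = y * e" for x y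
    using E(4)[of "x - y"] that by (simp add: left_diff_distrib)
  show ?thesis
  proof (rule that[OF R])
    fix r assume r: "r \<in> R"
    show "is_idempotent (h r)" unfolding is_idempotent_def
      by (rule local) (use h[OF r] in \<open>auto simp: mult.assoc\<close>)
    show "h r \<lless> h r" unfolding h_def by (rule reflexive_level_idempotent[OF assms N0])
    show "c * h r = r *\<^sub>R h r"
      by (rule local) (use h[OF r] \<rho> in \<open>auto simp: mult.assoc\<close>)
  next
    show "(\<Sum>r\<in>R. h r) = 1"
    proof (rule local)
      fix e assume e: "e \<in> E"
      have "(\<Sum>r\<in>R. h r) * e = (\<Sum>r\<in>R. if \<rho> e = r then e else 0)"
        unfolding sum_distrib_right by (rule sum.cong) (use h e in auto)
      \<comment> \<open>Only the index \<open>\<rho> e\<close> contributes to the sum.\<close>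
      also have "\<dots> = 1 * e" using R e by (simp add: R_def)
      finally show "(\<Sum>r\<in>R. h r) * e = 1 * e" .
    qed
  qed
qed

end


section \<open>Weak proximity morphisms on reflexive elements\<close>

locale weak_proximity_morphism_between =
  S: proximity prox + S': proximity prox' + weak_proximity_morphism prox prox' \<alpha>
  for prox :: "'a::ordered_baer_specker_algebra \<Rightarrow> 'a \<Rightarrow> bool"  (infix \<open>\<lless>\<close> 50)
    and prox' :: "'b::ordered_baer_specker_algebra \<Rightarrow> 'b \<Rightarrow> bool"  (infix \<open>\<lless>''\<close> 50)
    and \<alpha> :: "'a \<Rightarrow> 'b"
begin

lemma \<alpha>_mono: "a \<le> b \<Longrightarrow> \<alpha> a \<le> \<alpha> b"
  using PM2[of a b] by (simp add: inf_absorb1 inf.orderI)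

lemma \<alpha>_scaleR_one: "\<alpha> (r *\<^sub>R 1) = r *\<^sub>R 1"
  using PM7'[of 0 r] PM1 by simp

lemma \<alpha>_nonneg: "0 \<le> a \<Longrightarrow> 0 \<le> \<alpha> a"
  using \<alpha>_mono[of 0 a] PM1 by simp

text \<open>The identity \<open>inf (2 *\<^sub>R e) 1 = e\<close> holds for idempotents and uses
  only operations preserved by \<open>\<alpha>\<close>. In the target it makes
  \<open>\<alpha> e\<close> and \<open>1 - \<alpha> e\<close> disjoint, so their product is
  zero.\<close>

lemma \<alpha>_idempotent:
  assumes "is_idempotent e"
  shows "is_idempotent (\<alpha> e)"
proof -
  have "inf (2 *\<^sub>R e) 1 = e + inf e (1 - e)"
    by (simp add: add_inf_distrib_left scaleR_2)
  then have e: "inf (2 *\<^sub>R e) 1 = e" using inf_idempotent_diff[OF assms] by simp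
  have "inf (2 *\<^sub>R \<alpha> e) 1 = \<alpha> e"
    using PM2[of "2 *\<^sub>R e" 1] PM5[of 2 e] PM1 e by simp
  moreover have "inf (2 *\<^sub>R \<alpha> e) 1 = \<alpha> e + inf (\<alpha> e) (1 - \<alpha> e)"
    by (simp add: add_inf_distrib_left scaleR_2)
  ultimately have "\<alpha> e * (1 - \<alpha> e) = 0" by (intro disjoint_mult_eq_0) simp
  then show ?thesis by (simp add: is_idempotent_def algebra_simps)
qed

text \<open>Two inequalities. The images of \<open>e\<close> and \<open>1 - e\<close> are disjoint
  idempotents, so their sum is an idempotent and at most 1. Conversely, \<open>PM3\<close> applied
  to the reflexive \<open>e\<close> gives \<open>- \<alpha> (- e) \<le> \<alpha> e\<close>, which
  says that the sum is at least 1.\<close>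

lemma \<alpha>_idempotent_diff:
  assumes "is_idempotent e" "e \<lless> e"
  shows "\<alpha> (1 - e) = 1 - \<alpha> e"
proof -
  define f g where "f = \<alpha> e" and "g = \<alpha> (1 - e)"
  have g: "g = 1 + \<alpha> (- e)" using PM7'[of "- e" 1] by (simp add: g_def add.commute)
  have ff: "f * f = f" "g * g = g"
    using \<alpha>_idempotent[OF assms(1)] \<alpha>_idempotent[OF is_idempotent_diff[OF assms(1)]]
    by (simp_all add: f_def g_def is_idempotent_def)
  have "inf f g = 0"
    using PM2[of e "1 - e"] PM1 inf_idempotent_diff[OF assms(1)] by (simp add: f_def g_def)
  then have "f * g = 0" by (rule disjoint_mult_eq_0)
  then have "is_idempotent (f + g)"
    using ff by (simp add: is_idempotent_def algebra_simps)
  then have "f + g \<le> 1" by (rule idempotent_le_one)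
  moreover have "- \<alpha> (- e) \<le> f" using S'.P2[OF PM3[OF assms(2)]] by (simp add: f_def)
  then have "1 \<le> f + g" using g by (simp add: algebra_simps minus_le_iff)
     (metis add.commute add.right_inverse add_left_mono)
  ultimately have "f + g = 1" by simp
  then show ?thesis by (simp add: f_def g_def eq_diff_eq add.commute)
qed

text \<open>The product is an infimum with a multiple of \<open>e\<close>, and
  \<open>\<alpha>\<close> preserves constants and order, so the same bound \<open>n\<close> serves
  in the target.\<close>

lemma \<alpha>_mult_idempotent:
  assumes "is_idempotent e" "0 \<le> a"
  shows "\<alpha> (a * e) = \<alpha> a * \<alpha> e"
proof -
  obtain n :: nat where n: "1 \<le> n" "a \<le> real n *\<^sub>R 1" by (rule bal_bounded_nat)
  have "\<alpha> a \<le> real n *\<^sub>R 1" using \<alpha>_mono[OF n(2)] by (simp add: \<alpha>_scaleR_one)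
  then have "\<alpha> a * \<alpha> e = inf (\<alpha> a) (real n *\<^sub>R \<alpha> e)"
    using assms by (intro mult_idempotent_eq_inf \<alpha>_idempotent \<alpha>_nonneg)
  also have "\<dots> = \<alpha> (inf a (real n *\<^sub>R e))" using n by (simp add: PM2 PM5)
  finally show ?thesis using mult_idempotent_eq_inf[OF assms n(2)] by simp
qed

text \<open>Localization: what \<open>\<alpha> a\<close> is on \<open>\<alpha> e\<close> is
  determined by what \<open>a\<close> is on \<open>e\<close>. A constant shift, which commutes with
  \<open>\<alpha>\<close> by \<open>PM7'\<close>, reduces this to nonnegative elements.\<close>

lemma \<alpha>_cong_idempotent:
  assumes "is_idempotent e" "a * e = b * e"
  shows "\<alpha> a * \<alpha> e = \<alpha> b * \<alpha> e"
proof -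
  obtain n :: nat where n: "sup (- a) (- b) \<le> real n *\<^sub>R 1" by (rule bal_bounded_nat)
  define k :: real where "k = real n"
  have "- a \<le> k *\<^sub>R 1" "- b \<le> k *\<^sub>R 1" using n by (simp_all add: k_def)
  then have ab: "0 \<le> a + k *\<^sub>R 1" "0 \<le> b + k *\<^sub>R 1"
    by (metis add_left_mono add.right_inverse)+
  have "(a + k *\<^sub>R 1) * e = (b + k *\<^sub>R 1) * e" using assms(2) by (simp add: distrib_right)
  then have "\<alpha> (a + k *\<^sub>R 1) * \<alpha> e = \<alpha> (b + k *\<^sub>R 1) * \<alpha> e"
    using \<alpha>_mult_idempotent[OF assms(1)] ab by metis
  then show ?thesis by (simp add: PM7' distrib_right)
qed

text \<open>On \<open>e\<close> the summand \<open>e\<close> acts as the constant 1, so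
  \<open>PM7'\<close> applies; on \<open>1 - e\<close> it vanishes. Reflexivity makes the images of
  these two pieces complementary, so that they decide equality in the target.\<close>

lemma \<alpha>_add_idempotent:
  assumes "is_idempotent e" "e \<lless> e"
  shows "\<alpha> (a + e) = \<alpha> a + \<alpha> e"
proof (rule split_by_idempotent[where e = "\<alpha> e"])
  have ee: "e * e = e" "\<alpha> e * \<alpha> e = \<alpha> e"
    using assms(1) \<alpha>_idempotent by (auto simp: is_idempotent_def)
  have "(a + e) * e = (a + 1 *\<^sub>R 1) * e" using ee by (simp add: distrib_right)
  then have "\<alpha> (a + e) * \<alpha> e = \<alpha> (a + 1 *\<^sub>R 1) * \<alpha> e"
    by (rule \<alpha>_cong_idempotent[OF assms(1)])
  also have "\<dots> = (\<alpha> a + 1) * \<alpha> e" by (subst PM7') simp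
  also have "\<dots> = (\<alpha> a + \<alpha> e) * \<alpha> e" using ee by (simp add: distrib_right)
  finally show "\<alpha> (a + e) * \<alpha> e = (\<alpha> a + \<alpha> e) * \<alpha> e" .
  have "(a + e) * (1 - e) = a * (1 - e)" using ee by (simp add: algebra_simps)
  then have "\<alpha> (a + e) * \<alpha> (1 - e) = \<alpha> a * \<alpha> (1 - e)"
    by (rule \<alpha>_cong_idempotent[OF is_idempotent_diff[OF assms(1)]])
  then show "\<alpha> (a + e) * (1 - \<alpha> e) = (\<alpha> a + \<alpha> e) * (1 - \<alpha> e)"
    unfolding \<alpha>_idempotent_diff[OF assms] using ee by (simp add: algebra_simps)
qed

lemma \<alpha>_sum_idempotents:
  assumes "finite R" "\<And>r. r \<in> R \<Longrightarrow> is_idempotent (h r)" "\<And>r. r \<in> R \<Longrightarrow> h r \<lless> h r"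
  shows "\<alpha> (\<Sum>r\<in>R. h r) = (\<Sum>r\<in>R. \<alpha> (h r))"
  using assms
proof (induction R)
  case empty
  then show ?case by (simp add: PM1)
next
  case (insert r R)
  then show ?case using \<alpha>_add_idempotent[of "h r" "\<Sum>r\<in>R. h r"] by (simp add: add.commute)
qed

text \<open>The images of the level idempotents of \<open>c\<close> still sum to 1, so an equation
  in the target may be tested on each of them, where \<open>\<alpha> c\<close> is constant.\<close>

lemma eq_on_level_sets:
  assumes "c \<lless> c"
    and local: "\<And>e r. is_idempotent e \<Longrightarrow> c * e = r *\<^sub>R e \<Longrightarrow> \<alpha> c * \<alpha> e = r *\<^sub>R \<alpha> e \<Longrightarrow>
      x * \<alpha> e = y * \<alpha> e"
  shows "x = y"
proof -
  obtain R h where h: "finite R" "\<And>r. r \<in> R \<Longrightarrow> is_idempotent (h r)" "\<And>r. r \<in> R \<Longrightarrow> h r \<lless> h r"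
    "\<And>r. r \<in> R \<Longrightarrow> c * h r = r *\<^sub>R h r" "(\<Sum>r\<in>R. h r) = 1"
    using S.reflexive_decomposition[OF assms(1)] by blast
  have one: "(\<Sum>r\<in>R. \<alpha> (h r)) = 1"
    using \<alpha>_sum_idempotents[of R h, OF h(1-3)] h(5) PM1 by simp
  have eq: "x * \<alpha> (h r) = y * \<alpha> (h r)" if r: "r \<in> R" for r
  proof (rule local[OF h(2)[OF r] h(4)[OF r]])
    have "c * h r = (r *\<^sub>R 1) * h r" using h(4)[OF r] by simp
    then have "\<alpha> c * \<alpha> (h r) = \<alpha> (r *\<^sub>R 1) * \<alpha> (h r)"
      by (rule \<alpha>_cong_idempotent[OF h(2)[OF r]])
    then show "\<alpha> c * \<alpha> (h r) = r *\<^sub>R \<alpha> (h r)" by (simp add: \<alpha>_scaleR_one)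
  qed
  have "x = x * (\<Sum>r\<in>R. \<alpha> (h r))" using one by simp
  also have "\<dots> = y * (\<Sum>r\<in>R. \<alpha> (h r))" unfolding sum_distrib_left using eq by simp
  finally show ?thesis using one by simp
qed

text \<open>On each level set \<open>c\<close> may be replaced by a constant \<open>r\<close>, and
  \<open>PM6'\<close> handles constants. Addition below works the same way through
  \<open>PM7'\<close>.\<close>

lemma \<alpha>_sup_reflexive:
  assumes "c \<lless> c"
  shows "\<alpha> (sup a c) = sup (\<alpha> a) (\<alpha> c)"
proof (rule eq_on_level_sets[OF assms])
  fix e r assume e: "is_idempotent e" "c * e = r *\<^sub>R e" "\<alpha> c * \<alpha> e = r *\<^sub>R \<alpha> e"
  note sup_mult = sup_mult_idempotent[OF \<alpha>_idempotent[OF e(1)]]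
  have "sup a c * e = sup a (r *\<^sub>R 1) * e" using e by (simp add: sup_mult_idempotent)
  then have "\<alpha> (sup a c) * \<alpha> e = \<alpha> (sup a (r *\<^sub>R 1)) * \<alpha> e"
    by (rule \<alpha>_cong_idempotent[OF e(1)])
  then show "\<alpha> (sup a c) * \<alpha> e = sup (\<alpha> a) (\<alpha> c) * \<alpha> e"
    by (simp add: PM6' sup_mult e(3))
qed

lemma \<alpha>_add_reflexive:
  assumes "c \<lless> c"
  shows "\<alpha> (a + c) = \<alpha> a + \<alpha> c"
proof (rule eq_on_level_sets[OF assms])
  fix e r assume e: "is_idempotent e" "c * e = r *\<^sub>R e" "\<alpha> c * \<alpha> e = r *\<^sub>R \<alpha> e"
  have "(a + c) * e = (a + r *\<^sub>R 1) * e" using e by (simp add: distrib_right)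
  then have "\<alpha> (a + c) * \<alpha> e = \<alpha> (a + r *\<^sub>R 1) * \<alpha> e"
    by (rule \<alpha>_cong_idempotent[OF e(1)])
  then show "\<alpha> (a + c) * \<alpha> e = (\<alpha> a + \<alpha> c) * \<alpha> e"
    by (simp add: PM7' distrib_right e(3))
qed

lemma \<alpha>_mult_reflexive:
  assumes "c \<lless> c" "0 \<le> c"
  shows "\<alpha> (c * a) = \<alpha> c * \<alpha> a"
proof (rule eq_on_level_sets[OF assms(1)])
  fix e r assume e: "is_idempotent e" "c * e = r *\<^sub>R e" "\<alpha> c * \<alpha> e = r *\<^sub>R \<alpha> e"
  have e0: "0 \<le> e" using e(1) by (rule idempotent_nonneg)
  show "\<alpha> (c * a) * \<alpha> e = \<alpha> c * \<alpha> a * \<alpha> e"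
  proof (cases "0 \<le> r")
    case True
    have "c * a * e = (r *\<^sub>R a) * e" by (metis e(2) mult.assoc mult.commute mult_scaleR_left)
    then have "\<alpha> (c * a) * \<alpha> e = \<alpha> (r *\<^sub>R a) * \<alpha> e" by (rule \<alpha>_cong_idempotent[OF e(1)])
    \<comment> \<open>\<open>PM5\<close> covers only positive scalars; zero is settled by
      \<open>PM1\<close>.\<close>
    also have "\<alpha> (r *\<^sub>R a) = r *\<^sub>R \<alpha> a"
      using True by (cases "r = 0") (simp_all add: PM1 PM5)
    also have "r *\<^sub>R \<alpha> a * \<alpha> e = \<alpha> c * \<alpha> a * \<alpha> e"
      by (metis e(3) mult.assoc mult.commute mult_scaleR_left)
    finally show ?thesis .
  next
    case False
    \<comment> \<open>A negative level of the nonnegative \<open>c\<close> is empty: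
      \<open>c * e\<close> is both nonnegative and nonpositive, which forces \<open>e\<close> to be
      zero.\<close>
    have "0 \<le> r *\<^sub>R e" using e(2) assms(2) e0 by (metis mult_nonneg_nonneg)
    moreover have "r *\<^sub>R e \<le> 0" using False e0 by (intro scaleR_nonpos_nonneg) auto
    ultimately have "r *\<^sub>R e = 0" by simp
    then have "e = 0" using False by simp
    then show ?thesis by (simp add: PM1)
  qed
qed

end

section \<open>Real constants under proximity morphisms, and the equivalence\<close>

lemma (in proximity_morphism) \<alpha>_scaleR_one_of_proximity:
  assumes "proximity prox"
  shows "\<alpha> (r *\<^sub>R 1) = r *\<^sub>R 1"
proof -
  interpret proximity prox by fact
  have pos: "\<alpha> (s *\<^sub>R 1) = s *\<^sub>R 1" if "0 < s" for s using that by (simp add: PM1 PM5)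
  show ?thesis
  proof (cases r "0::real" rule: linorder_cases)
    case less
    \<comment> \<open>Positive constants are fixed by \<open>PM5\<close>. A negative one is reached
      by additivity: it is reflexive, and adding its opposite gives zero.\<close>
    have "\<alpha> ((- r) *\<^sub>R 1 + r *\<^sub>R 1) = \<alpha> ((- r) *\<^sub>R 1) + \<alpha> (r *\<^sub>R 1)"
      by (rule PM7[OF reflexive_scaleR_one])
    then have "- (r *\<^sub>R 1) + \<alpha> (r *\<^sub>R 1) = 0" using pos[of "- r"] less by (simp add: PM1)
    then show ?thesis by (simp add: neg_eq_iff_add_eq_0[symmetric])
  qed (simp_all add: PM1 pos)
qed

theorem theoremA8:
  fixes prox :: "'a::ordered_baer_specker_algebra \<Rightarrow> 'a \<Rightarrow> bool"
    and prox' :: "'b::ordered_baer_specker_algebra \<Rightarrow> 'b \<Rightarrow> bool"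
    and \<alpha> :: "'a \<Rightarrow> 'b"
  assumes "proximity prox" and "proximity prox'"
  shows "proximity_morphism prox prox' \<alpha> \<longleftrightarrow> weak_proximity_morphism prox prox' \<alpha>"
proof
  assume "proximity_morphism prox prox' \<alpha>"
  then interpret proximity_morphism prox prox' \<alpha> .
  interpret proximity prox by fact
  note const = \<alpha>_scaleR_one_of_proximity[OF assms(1)]
  show "weak_proximity_morphism prox prox' \<alpha>"
    \<comment> \<open>Real constants are reflexive and fixed by \<open>\<alpha>\<close>, so
      \<open>PM6'\<close> and \<open>PM7'\<close> are the instances of \<open>PM6\<close> and
      \<open>PM7\<close> at constants.\<close>
    by unfold_locales
       (simp_all add: PM6[OF reflexive_scaleR_one] PM7[OF reflexive_scaleR_one] const)
next
  assume "weak_proximity_morphism prox prox' \<alpha>"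
  with assms interpret weak_proximity_morphism_between prox prox' \<alpha>
    by (simp add: weak_proximity_morphism_between_def)
  show "proximity_morphism prox prox' \<alpha>"
    by unfold_locales (simp_all add: \<alpha>_sup_reflexive \<alpha>_add_reflexive \<alpha>_mult_reflexive)
qed

end
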